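(* Let $R$ be a commutative ring with unit and let $\mathcal{G}$ be an ample and Hausdorff groupoid with unit space $\mathcal{G}^{(0)}$. Let $\mathcal{G}^a$ be the inverse semigroup of compact bisections of $\mathcal{G}$, let $\theta$ be the partial action of $\mathcal{G}^a$ on $\mathcal{G}^{(0)}$ given by $\theta_B: s(B)\to r(B)$, $\theta_B(u)=r_B(s_B^{-1}(u))$, and let $\alpha$ be the corresponding partial action of $\mathcal{G}^a$ on the $R$-algebra $\mathcal{L}_c(\mathcal{G}^{(0)})$. Then the Steinberg algebra $A_R(\mathcal{G})$ is isomorphic, as an $R$-algebra, to the partial skew inverse semigroup ring $\mathcal{L}_c(\mathcal{G}^{(0)})\rtimes_\alpha\mathcal{G}^a$.
   Context: Groupoids: for a groupoid $\mathcal{G}$, $r(b)=bb^{-1}$, $s(b)=b^{-1}b$, and $(b,c)$ is composable iff $s(b)=r(c)$. A topological groupoid is étale if $\mathcal{G}^{(0)}$ is locally compact Hausdorff in the relative topology and $r:\mathcal{G}\to\mathcal{G}^{(0)}$ is a local homeomorphism. A bisection is an open subset $B\subseteq\mathcal{G}$ such that $r|_B$ and $s|_B$ are injective. An étale groupoid is ample if it has a basis of compact open bisections. Inverse semigroup of bisections: $\mathcal{G}^a$ is the set of all compact (open) bisections of $\mathcal{G}$ (possibly empty), with product $BC=\{bc: b\in B, c\in C, s(b)=r(c)\}$ and involution $B^*=B^{-1}=\{b^{-1}:b\in B\}$. Its natural partial order is $A\le B\Leftrightarrow A\subseteq B$. For $B\in\mathcal{G}^a$, $s_B:B\to s(B)$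 and $r_B:B\to r(B)$ are the restrictions of $s$ and $r$; they are homeomorphisms onto compact open subsets of $\mathcal{G}^{(0)}$. The partial action $\alpha$: $\mathcal{L}_c(\mathcal{G}^{(0)})$ is the $R$-algebra (pointwise operations) of locally constant, compactly supported functions $\mathcal{G}^{(0)}\to R$. For $B\in\mathcal{G}^a$ let $D_B=\{f\in\mathcal{L}_c(\mathcal{G}^{(0)}): f(x)=0\ \forall x\in\mathcal{G}^{(0)}\setminus r(B)\}$, so that $D_{B^*}$ consists of the functions vanishing outside $s(B)$, and let $\alpha_B:D_{B^*}\to D_B$ be given by $\alpha_B(f)(x)=f(\theta_{B^*}(x))$ if $x\in r(B)$ and $\alpha_B(f)(x)=0$ if $x\notin r(B)$. Partial skew inverse semigroup ring: let $\mathcal{L}$ be the $R$-module of all finite formal sums $\sum_{B\in\mathcal{G}^a}f_B\delta_B$ with $f_B\in D_B$, with product the linear extension of $(f_B\delta_B)(f_C\delta_C)=\alpha_B(\alpha_{B^*}(f_B)f_C)\delta_{BC}$. Let $\mathcal{I}$ be the (two-sided) ideal of $\mathcal{L}$ generated by all elements $f\delta_B-f\delta_A$ with $B\le A$ in $\mathcal{G}^a$ and $f\in D_B$ (note $D_B\subseteq D_A$). Then $\mathcal{L}_c(\mathcal{G}^{(0)})\rtimes_\alpha\mathcal{G}^a=\mathcal{L}/\mathcal{I}$. Steinberg algebra: $A_R(\mathcal{G})$ is the $R$-algebra of all locally constant functions $f:\mathcal{G}\to R$ with compact support $\{b: f(b)\ne0\}$, with pointwise addition and convolution $(f*g)(b)=\sum_{cd=b}f(c)g(d)$.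 *)

theory Defs
  imports "HOL-Analysis.Analysis"
begin

section \<open>Topological groupoids\<close>

text \<open>
  The set of arrows is the topspace of the topology. The multiplication is only meaningful on
  composable pairs; its values elsewhere are junk.
\<close>

record 'g groupoid_data =
  gtop :: "'g topology"
  gmult :: "'g \<Rightarrow> 'g \<Rightarrow> 'g"
  ginv :: "'g \<Rightarrow> 'g"

abbreviation arrows :: "'g groupoid_data \<Rightarrow> 'g set" where
  "arrows G \<equiv> topspace (gtop G)"

definition rng :: "'g groupoid_data \<Rightarrow> 'g \<Rightarrow> 'g" where
  "rng G b = gmult G b (ginv G b)"

definition src :: "'g groupoid_data \<Rightarrow> 'g \<Rightarrow> 'g" where
  "src G b = gmult G (ginv G b) b"

definition composable :: "'g groupoid_data \<Rightarrow> ('g \<times> 'g) set" where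
  "composable G = {(b, c). b \<in> arrows G \<and> c \<in> arrows G \<and> src G b = rng G c}"

definition units :: "'g groupoid_data \<Rightarrow> 'g set" where
  "units G = rng G ` arrows G"

definition unit_space :: "'g groupoid_data \<Rightarrow> 'g topology" where
  "unit_space G = subtopology (gtop G) (units G)"

text \<open>
  The axioms are the usual ones for a set with a partially defined associative product and an
  involutive inverse satisfying the two cancellation laws; the unit laws, and
  \<open>units G = src G ` arrows G\<close>, follow from them.
\<close>

locale groupoid =
  fixes G :: "'g groupoid_data"
  assumes ginv_closed: "b \<in> arrows G \<Longrightarrow> ginv G b \<in> arrows G"
    and ginv_ginv: "b \<in> arrows G \<Longrightarrow> ginv G (ginv G b) = b"
    and gmult_closed: "(b, c) \<in> composable G \<Longrightarrow> gmult G b c \<in> arrows G"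
    and rng_gmult: "(b, c) \<in> composable G \<Longrightarrow> rng G (gmult G b c) = rng G b"
    and src_gmult: "(b, c) \<in> composable G \<Longrightarrow> src G (gmult G b c) = src G c"
    and gmult_assoc: "\<lbrakk>(b, c) \<in> composable G; (c, d) \<in> composable G\<rbrakk>
      \<Longrightarrow> gmult G (gmult G b c) d = gmult G b (gmult G c d)"
    and left_cancel: "(b, c) \<in> composable G \<Longrightarrow> gmult G (ginv G b) (gmult G b c) = c"
    and right_cancel: "(b, c) \<in> composable G \<Longrightarrow> gmult G (gmult G b c) (ginv G c) = b"

locale topological_groupoid = groupoid +
  assumes continuous_gmult:
      "continuous_map (subtopology (prod_topology (gtop G) (gtop G)) (composable G)) (gtop G)
        (\<lambda>(b, c). gmult G b c)"
    and continuous_ginv: "continuous_map (gtop G) (gtop G) (ginv G)"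

definition local_homeomorphism :: "'a topology \<Rightarrow> 'b topology \<Rightarrow> ('a \<Rightarrow> 'b) \<Rightarrow> bool" where
  "local_homeomorphism X Y f \<longleftrightarrow>
    (\<forall>x \<in> topspace X. \<exists>U. openin X U \<and> x \<in> U \<and> openin Y (f ` U) \<and>
      homeomorphic_map (subtopology X U) (subtopology Y (f ` U)) f)"

locale etale_groupoid = topological_groupoid +
  assumes locally_compact_unit_space: "locally_compact_space (unit_space G)"
    and Hausdorff_unit_space: "Hausdorff_space (unit_space G)"
    and local_homeomorphism_rng: "local_homeomorphism (gtop G) (unit_space G) (rng G)"

definition bisection :: "'g groupoid_data \<Rightarrow> 'g set \<Rightarrow> bool" where
  "bisection G B \<longleftrightarrow> openin (gtop G) B \<and> inj_on (rng G) B \<and> inj_on (src G) B"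

definition compact_bisections :: "'g groupoid_data \<Rightarrow> 'g set set" where
  "compact_bisections G = {B. bisection G B \<and> compactin (gtop G) B}"

text \<open>The hypothesis below says that the compact open bisections form a basis of the topology.\<close>

locale ample_groupoid = etale_groupoid +
  assumes compact_bisections_basis:
    "openin (gtop G) = arbitrary union_of (\<lambda>B. B \<in> compact_bisections G)"


section \<open>The inverse semigroup of compact bisections and its partial action\<close>

definition bis_mult :: "'g groupoid_data \<Rightarrow> 'g set \<Rightarrow> 'g set \<Rightarrow> 'g set" where
  "bis_mult G B C = {gmult G b c | b c. b \<in> B \<and> c \<in> C \<and> src G b = rng G c}"

definition bis_inv :: "'g groupoid_data \<Rightarrow> 'g set \<Rightarrow> 'g set" where
  "bis_inv G B = ginv G ` B"

definition theta :: "'g groupoid_data \<Rightarrow> 'g set \<Rightarrow> 'g \<Rightarrow> 'g" where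
  "theta G B u = rng G (the_inv_into B (src G) u)"

text \<open>
  Locally constant, compactly supported functions on a space, represented as total functions that
  vanish outside the topspace. (For a locally constant function the set of points where it is
  nonzero is closed, hence equal to its support.)

  The sort \<open>{comm_ring, comm_monoid_mult}\<close> is that of commutative rings with unit. In contrast to
  \<open>comm_ring_1\<close> it does not exclude the zero ring.
\<close>

definition loc_const_fun ::
    "'a topology \<Rightarrow> ('a \<Rightarrow> 'r::{comm_ring, comm_monoid_mult}) set" where
  "loc_const_fun X = {f.
     (\<forall>x. x \<notin> topspace X \<longrightarrow> f x = 0) \<and>
     (\<forall>x \<in> topspace X. \<exists>U. openin X U \<and> x \<in> U \<and> (\<forall>y \<in> U. f y = f x)) \<and>
     compactin X {x \<in> topspace X. f x \<noteq> 0}}"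

definition action_dom ::
    "'g groupoid_data \<Rightarrow> 'g set \<Rightarrow> ('g \<Rightarrow> 'r::{comm_ring, comm_monoid_mult}) set" where
  "action_dom G B = {f \<in> loc_const_fun (unit_space G). \<forall>x \<in> units G - rng G ` B. f x = 0}"

definition action ::
    "'g groupoid_data \<Rightarrow> 'g set \<Rightarrow> ('g \<Rightarrow> 'r::{comm_ring, comm_monoid_mult}) \<Rightarrow> 'g \<Rightarrow> 'r" where
  "action G B f = (\<lambda>x. if x \<in> rng G ` B then f (theta G (bis_inv G B) x) else 0)"


section \<open>Algebras, ideals, quotients and isomorphisms\<close>

text \<open>
  The algebras below need not have a unit, so the ring records of \<open>HOL-Algebra\<close> do not fit.
\<close>

record ('r, 'a) alg_data =
  acarrier :: "'a set"
  azero :: "'a"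
  aadd :: "'a \<Rightarrow> 'a \<Rightarrow> 'a"
  amult :: "'a \<Rightarrow> 'a \<Rightarrow> 'a"
  ascale :: "'r \<Rightarrow> 'a \<Rightarrow> 'a"

text \<open>Closure under additive inverses follows from scaling by \<open>- 1\<close>.\<close>

definition two_sided_ideal :: "('r, 'a) alg_data \<Rightarrow> 'a set \<Rightarrow> bool" where
  "two_sided_ideal A J \<longleftrightarrow>
     J \<subseteq> acarrier A \<and> azero A \<in> J \<and>
     (\<forall>x \<in> J. \<forall>y \<in> J. aadd A x y \<in> J) \<and>
     (\<forall>c. \<forall>x \<in> J. ascale A c x \<in> J) \<and>
     (\<forall>a \<in> acarrier A. \<forall>x \<in> J. amult A a x \<in> J \<and> amult A x a \<in> J)"

definition generated_ideal :: "('r, 'a) alg_data \<Rightarrow> 'a set \<Rightarrow> 'a set" where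
  "generated_ideal A S = \<Inter>{J. two_sided_ideal A J \<and> S \<subseteq> J}"

definition acoset :: "('r, 'a) alg_data \<Rightarrow> 'a set \<Rightarrow> 'a \<Rightarrow> 'a set" where
  "acoset A J x = aadd A x ` J"

text \<open>
  The operations on cosets are induced by those on representatives; since \<open>J\<close> is an ideal, each
  union below is a union of equal cosets.
\<close>

definition quotient_alg :: "('r, 'a) alg_data \<Rightarrow> 'a set \<Rightarrow> ('r, 'a set) alg_data" where
  "quotient_alg A J = \<lparr>
     acarrier = acoset A J ` acarrier A,
     azero = acoset A J (azero A),
     aadd = (\<lambda>X Y. \<Union>x\<in>X. \<Union>y\<in>Y. acoset A J (aadd A x y)),
     amult = (\<lambda>X Y. \<Union>x\<in>X. \<Union>y\<in>Y. acoset A J (amult A x y)),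
     ascale = (\<lambda>c X. \<Union>x\<in>X. acoset A J (ascale A c x))\<rparr>"

definition alg_iso :: "('r, 'a) alg_data \<Rightarrow> ('r, 'b) alg_data \<Rightarrow> ('a \<Rightarrow> 'b) set" where
  "alg_iso A B = {h. bij_betw h (acarrier A) (acarrier B) \<and>
     (\<forall>x \<in> acarrier A. \<forall>y \<in> acarrier A. h (aadd A x y) = aadd B (h x) (h y)) \<and>
     (\<forall>x \<in> acarrier A. \<forall>y \<in> acarrier A. h (amult A x y) = amult B (h x) (h y)) \<and>
     (\<forall>c. \<forall>x \<in> acarrier A. h (ascale A c x) = ascale B c (h x))}"

definition alg_isomorphic :: "('r, 'a) alg_data \<Rightarrow> ('r, 'b) alg_data \<Rightarrow> bool" where
  "alg_isomorphic A B \<longleftrightarrow> alg_iso A B \<noteq> {}"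


section \<open>The partial skew inverse semigroup ring\<close>

text \<open>
  A formal sum of terms \<open>f\<^sub>B \<delta>\<^sub>B\<close> is the finitely supported function \<open>B \<mapsto> f\<^sub>B\<close>, extended by zero
  to all sets \<open>B\<close>; \<open>single B f\<close> is the one-term sum \<open>f \<delta>\<^sub>B\<close>.
\<close>

definition single :: "'g set \<Rightarrow> ('g \<Rightarrow> 'r::zero) \<Rightarrow> 'g set \<Rightarrow> 'g \<Rightarrow> 'r" where
  "single B f = (\<lambda>_ _. 0)(B := f)"

definition fsupp :: "('g set \<Rightarrow> 'g \<Rightarrow> 'r::zero) \<Rightarrow> 'g set set" where
  "fsupp F = {B. F B \<noteq> (\<lambda>_. 0)}"

definition formal_mult ::
    "'g groupoid_data \<Rightarrow> ('g set \<Rightarrow> 'g \<Rightarrow> 'r::{comm_ring, comm_monoid_mult})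
      \<Rightarrow> ('g set \<Rightarrow> 'g \<Rightarrow> 'r) \<Rightarrow> 'g set \<Rightarrow> 'g \<Rightarrow> 'r" where
  "formal_mult G F H = (\<lambda>A x. \<Sum>B\<in>fsupp F. \<Sum>C\<in>fsupp H.
     single (bis_mult G B C) (action G B (\<lambda>y. action G (bis_inv G B) (F B) y * H C y)) A x)"

definition formal_alg ::
    "'g groupoid_data
      \<Rightarrow> ('r::{comm_ring, comm_monoid_mult}, 'g set \<Rightarrow> 'g \<Rightarrow> 'r) alg_data" where
  "formal_alg G = \<lparr>
     acarrier = {F. finite (fsupp F) \<and> fsupp F \<subseteq> compact_bisections G \<and>
                    (\<forall>B \<in> compact_bisections G. F B \<in> action_dom G B)},
     azero = (\<lambda>_ _. 0),
     aadd = (\<lambda>F H B x. F B x + H B x),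
     amult = formal_mult G,
     ascale = (\<lambda>c F B x. c * F B x)\<rparr>"

definition skew_relations ::
    "'g groupoid_data \<Rightarrow> ('g set \<Rightarrow> 'g \<Rightarrow> 'r::{comm_ring, comm_monoid_mult}) set" where
  "skew_relations G = {(\<lambda>C x. single B f C x - single A f C x) | A B f.
     A \<in> compact_bisections G \<and> B \<in> compact_bisections G \<and> B \<subseteq> A \<and> f \<in> action_dom G B}"

definition skew_ring ::
    "'g groupoid_data
      \<Rightarrow> ('r::{comm_ring, comm_monoid_mult}, ('g set \<Rightarrow> 'g \<Rightarrow> 'r) set) alg_data" where
  "skew_ring G = quotient_alg (formal_alg G) (generated_ideal (formal_alg G) (skew_relations G))"


section \<open>The Steinberg algebra\<close>

text \<open>
  \<open>sum'\<close> is the sum over the indices with nonzero summand. For functions in the carrier below and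
  \<open>G\<close> ample and Hausdorff there are only finitely many of them.
\<close>

definition convolution ::
    "'g groupoid_data \<Rightarrow> ('g \<Rightarrow> 'r::{comm_ring, comm_monoid_mult}) \<Rightarrow> ('g \<Rightarrow> 'r) \<Rightarrow> 'g \<Rightarrow> 'r" where
  "convolution G f g =
    (\<lambda>b. sum' (\<lambda>(c, d). f c * g d) {(c, d) \<in> composable G. gmult G c d = b})"

definition steinberg_alg ::
    "'g groupoid_data \<Rightarrow> ('r::{comm_ring, comm_monoid_mult}, 'g \<Rightarrow> 'r) alg_data" where
  "steinberg_alg G = \<lparr>
     acarrier = loc_const_fun (gtop G),
     azero = (\<lambda>_. 0),
     aadd = (\<lambda>f g x. f x + g x),
     amult = convolution G,
     ascale = (\<lambda>c f x. c * f x)\<rparr>"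

end

theory Submission
  imports Defs
begin

text \<open>
  The formal sum of the terms \<open>f\<^sub>B \<delta>\<^sub>B\<close> is sent to the function \<open>b \<mapsto> \<Sum>\<^sub>B f\<^sub>B (r b)\<close>, the sum running
  over the bisections \<open>B\<close> that contain \<open>b\<close>. On a single term this is a bijection from \<open>D\<^sub>B\<close> onto the
  elements of the Steinberg algebra supported in \<open>B\<close>, and \<open>\<delta>\<^sub>B \<delta>\<^sub>C = \<delta>\<^sub>B\<^sub>C\<close> matches convolution because
  an element of \<open>BC\<close> factors uniquely. Compact bisections are clopen, so supports can be cut into
  disjoint compact bisections; this gives surjectivity, and shows that the kernel is the ideal
  generated by the relations.
\<close>

section \<open>Locally constant functions\<close>

text \<open>The locality clause of \<open>loc_const_fun\<close> on its own, without compact support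
  and for arbitrary values, so that it can be checked on subspaces and pulled back along continuous
  maps.\<close>

definition locally_constant :: "'a topology \<Rightarrow> ('a \<Rightarrow> 'b) \<Rightarrow> bool" where
  "locally_constant X f \<longleftrightarrow>
    (\<forall>x \<in> topspace X. \<exists>U. openin X U \<and> x \<in> U \<and> (\<forall>y \<in> U. f y = f x))"

lemma locally_constant_const: "locally_constant X (\<lambda>x. c)"
  unfolding locally_constant_def by blast

lemma locally_constant_comp2:
  assumes f: "locally_constant X f" and g: "locally_constant X g"
  shows "locally_constant X (\<lambda>x. h (f x) (g x))"
  unfolding locally_constant_def
proof
  fix x assume x: "x \<in> topspace X"
  obtain U where "openin X U" "x \<in> U" "\<forall>y \<in> U. f y = f x"
    using f x unfolding locally_constant_def by blast
  moreover obtain V where "openin X V" "x \<in> V" "\<forall>y \<in> V. g y = g x"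
    using g x unfolding locally_constant_def by blast
  ultimately show "\<exists>U. openin X U \<and> x \<in> U \<and> (\<forall>y \<in> U. h (f y) (g y) = h (f x) (g x))"
    by (intro exI[of _ "U \<inter> V"]) (metis IntD1 IntD2 IntI openin_Int)
qed

lemma locally_constant_compose:
  assumes k: "continuous_map X Y k" and f: "locally_constant Y f"
  shows "locally_constant X (\<lambda>x. f (k x))"
  unfolding locally_constant_def
proof
  fix x assume x: "x \<in> topspace X"
  then have "k x \<in> topspace Y"
    using k by (auto simp: continuous_map_def)
  then obtain U where U: "openin Y U" "k x \<in> U" "\<forall>y \<in> U. f y = f (k x)"
    using f unfolding locally_constant_def by blast
  have "openin X {y \<in> topspace X. k y \<in> U}"
    using k U(1) by (simp add: continuous_map_def)
  then show "\<exists>U. openin X U \<and> x \<in> U \<and> (\<forall>y \<in> U. f (k y) = f (k x))"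
    using U x by (intro exI[of _ "{y \<in> topspace X. k y \<in> U}"]) blast
qed

lemma locally_constant_subtopology:
  "locally_constant X f \<Longrightarrow> locally_constant (subtopology X S) f"
  using locally_constant_compose[OF continuous_map_from_subtopology[OF continuous_map_id]]
  by fastforce

text \<open>Outside \<open>B\<close> the complement of \<open>B\<close> serves as neighbourhood,
  being open because \<open>B\<close> is closed. Inside \<open>B\<close>, a set open in the subspace
  is open in \<open>X\<close>.\<close>

lemma locally_constant_extend:
  assumes B: "openin X B" "closedin X B" and f: "locally_constant (subtopology X B) f"
  shows "locally_constant X (\<lambda>x. if x \<in> B then f x else c)"
  unfolding locally_constant_def
proof
  fix x assume x: "x \<in> topspace X"
  show "\<exists>U. openin X U \<and> x \<in> U \<and>
      (\<forall>y \<in> U. (if y \<in> B then f y else c) = (if x \<in> B then f x else c))"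
  proof (cases "x \<in> B")
    case True
    then obtain U where U: "openin (subtopology X B) U" "x \<in> U" "\<forall>y \<in> U. f y = f x"
      using f x unfolding locally_constant_def by (metis IntI topspace_subtopology)
    have "openin X U"
      using openin_trans_full[OF U(1) B(1)] .
    moreover have "U \<subseteq> B"
      using openin_subset[OF U(1)] by auto
    ultimately show ?thesis using U True by (intro exI[of _ U]) (metis subsetD)
  next
    case False
    then show ?thesis
      using x B(2) by (intro exI[of _ "topspace X - B"]) (auto simp: closedin_def)
  qed
qed

text \<open>Local constancy makes the zero set open, so the support is a closed subset of the
  compact set \<open>K\<close> and hence compact.\<close>

lemma loc_const_funI:
  assumes "locally_constant X f" "compactin X K" "\<And>x. x \<notin> K \<Longrightarrow> f x = 0"
  shows "f \<in> loc_const_fun X"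
proof -
  have "openin X {x \<in> topspace X. f x = 0}"
  proof (subst openin_subopen, safe)
    fix x assume x: "x \<in> topspace X" "f x = 0"
    then obtain U where U: "openin X U" "x \<in> U" "\<forall>y \<in> U. f y = f x"
      using assms(1) unfolding locally_constant_def by blast
    then show "\<exists>T. openin X T \<and> x \<in> T \<and> T \<subseteq> {x \<in> topspace X. f x = 0}"
      using x(2) openin_subset[OF U(1)]
      by (intro exI[of _ U]) (metis (mono_tags, lifting) mem_Collect_eq subset_iff)
  qed
  moreover have "{x \<in> topspace X. f x \<noteq> 0} = topspace X - {x \<in> topspace X. f x = 0}"
    by auto
  ultimately have "closedin X {x \<in> topspace X. f x \<noteq> 0}"
    by (simp add: closedin_diff)
  moreover have "{x \<in> topspace X. f x \<noteq> 0} \<subseteq> K"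
    using assms(3) by auto
  ultimately have "compactin X {x \<in> topspace X. f x \<noteq> 0}"
    using assms(2) closed_compactin by blast
  moreover have "f x = 0" if "x \<notin> topspace X" for x
    using that assms(2,3) compactin_subset_topspace by blast
  ultimately show ?thesis
    using assms(1) by (auto simp: loc_const_fun_def locally_constant_def)
qed

lemma loc_const_fun_locally_constant: "f \<in> loc_const_fun X \<Longrightarrow> locally_constant X f"
  by (simp add: loc_const_fun_def locally_constant_def)

lemma loc_const_fun_compact_support:
  assumes "f \<in> loc_const_fun X"
  shows "compactin X {x. f x \<noteq> 0}"
proof -
  have "{x. f x \<noteq> 0} = {x \<in> topspace X. f x \<noteq> 0}"
    using assms by (auto simp: loc_const_fun_def)
  then show ?thesis using assms by (simp add: loc_const_fun_def)
qed

lemma loc_const_fun_zero: "(\<lambda>x. 0) \<in> loc_const_fun X"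
  by (rule loc_const_funI[where K = "{}"]) (auto simp: locally_constant_const)

lemma loc_const_fun_add:
  assumes "f \<in> loc_const_fun X" "g \<in> loc_const_fun X"
  shows "(\<lambda>x. f x + g x) \<in> loc_const_fun X"
proof (rule loc_const_funI)
  show "locally_constant X (\<lambda>x. f x + g x)"
    using assms by (rule locally_constant_comp2[OF loc_const_fun_locally_constant
        loc_const_fun_locally_constant])
  show "compactin X ({x. f x \<noteq> 0} \<union> {x. g x \<noteq> 0})"
    using assms by (intro compactin_Un loc_const_fun_compact_support)
qed auto

lemma loc_const_fun_scale:
  assumes "f \<in> loc_const_fun X"
  shows "(\<lambda>x. c * f x) \<in> loc_const_fun X"
proof (rule loc_const_funI)
  show "locally_constant X (\<lambda>x. c * f x)"
    using assms locally_constant_comp2[of X f f "\<lambda>a b. c * a"]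
    by (simp add: loc_const_fun_locally_constant)
  show "compactin X {x. f x \<noteq> 0}"
    using assms by (rule loc_const_fun_compact_support)
qed auto

lemma loc_const_fun_sum:
  "(\<And>i. i \<in> I \<Longrightarrow> f i \<in> loc_const_fun X) \<Longrightarrow> (\<lambda>x. \<Sum>i\<in>I. f i x) \<in> loc_const_fun X"
  by (induction I rule: infinite_finite_induct) (auto simp: loc_const_fun_zero loc_const_fun_add)

lemma loc_const_fun_restrict:
  assumes "f \<in> loc_const_fun X" "openin X B" "closedin X B"
  shows "(\<lambda>x. if x \<in> B then f x else 0) \<in> loc_const_fun X"
proof (rule loc_const_funI)
  show "locally_constant X (\<lambda>x. if x \<in> B then f x else 0)"
    using assms
    by (blast intro: locally_constant_extend locally_constant_subtopology
        loc_const_fun_locally_constant)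
  show "compactin X {x. f x \<noteq> 0}"
    using assms(1) by (rule loc_const_fun_compact_support)
qed auto


section \<open>Quotient algebras by fibres of a homomorphism\<close>

text \<open>The isomorphism sends an element to its fibre.\<close>

lemma alg_isomorphic_quotient_alg:
  assumes img: "\<phi> ` acarrier A = acarrier B"
    and coset: "\<And>x. x \<in> acarrier A \<Longrightarrow> acoset A J x = {y \<in> acarrier A. \<phi> y = \<phi> x}"
    and add: "\<And>x y. \<lbrakk>x \<in> acarrier A; y \<in> acarrier A\<rbrakk>
      \<Longrightarrow> aadd A x y \<in> acarrier A \<and> \<phi> (aadd A x y) = aadd B (\<phi> x) (\<phi> y)"
    and mult: "\<And>x y. \<lbrakk>x \<in> acarrier A; y \<in> acarrier A\<rbrakk>
      \<Longrightarrow> amult A x y \<in> acarrier A \<and> \<phi> (amult A x y) = amult B (\<phi> x) (\<phi> y)"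
    and scale: "\<And>c x. x \<in> acarrier A
      \<Longrightarrow> ascale A c x \<in> acarrier A \<and> \<phi> (ascale A c x) = ascale B c (\<phi> x)"
  shows "alg_isomorphic B (quotient_alg A J)"
proof -
  define h where "h f = {y \<in> acarrier A. \<phi> y = f}" for f
  have h: "h f \<noteq> {}" if "f \<in> acarrier B" for f
    using that unfolding h_def img[symmetric] by auto
  have coset': "acoset A J x = h (\<phi> x)" if "x \<in> acarrier A" for x
    using coset[OF that] by (simp add: h_def)
  have inj: "inj_on h (acarrier B)"
    using h by (intro inj_onI) (fastforce simp: h_def)
  have image: "h ` acarrier B = acoset A J ` acarrier A"
    unfolding img[symmetric] image_image using coset' by simp
  \<comment> \<open>All choices of representatives yield the same fibre, and fibres over the carrier
    of \<open>B\<close> are nonempty by surjectivity, so the union collapses to one coset. The other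
    two operations are treated alike.\<close>
  have h_add: "h (aadd B f g) = (\<Union>x\<in>h f. \<Union>y\<in>h g. acoset A J (aadd A x y))"
    if "f \<in> acarrier B" "g \<in> acarrier B" for f g
  proof -
    have "acoset A J (aadd A x y) = h (aadd B f g)" if "x \<in> h f" "y \<in> h g" for x y
      using that add[of x y] by (auto simp: h_def coset')
    then show ?thesis using h[OF that(1)] h[OF that(2)] by auto
  qed
  have h_mult: "h (amult B f g) = (\<Union>x\<in>h f. \<Union>y\<in>h g. acoset A J (amult A x y))"
    if "f \<in> acarrier B" "g \<in> acarrier B" for f g
  proof -
    have "acoset A J (amult A x y) = h (amult B f g)" if "x \<in> h f" "y \<in> h g" for x y
      using that mult[of x y] by (auto simp: h_def coset')
    then show ?thesis using h[OF that(1)] h[OF that(2)] by auto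
  qed
  have h_scale: "h (ascale B c f) = (\<Union>x\<in>h f. acoset A J (ascale A c x))"
    if "f \<in> acarrier B" for c f
  proof -
    have "acoset A J (ascale A c x) = h (ascale B c f)" if "x \<in> h f" for x
      using that scale[of x c] by (auto simp: h_def coset')
    then show ?thesis using h[OF that] by auto
  qed
  have "h \<in> alg_iso B (quotient_alg A J)"
    using inj image h_add h_mult h_scale
    by (simp add: alg_iso_def quotient_alg_def bij_betw_def)
  then show ?thesis by (auto simp: alg_isomorphic_def)
qed


section \<open>Groupoids and compact bisections\<close>

context groupoid
begin

lemma rng_ginv: "b \<in> arrows G \<Longrightarrow> rng G (ginv G b) = src G b"
  by (simp add: rng_def src_def ginv_ginv)

lemma src_ginv: "b \<in> arrows G \<Longrightarrow> src G (ginv G b) = rng G b"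
  by (simp add: rng_def src_def ginv_ginv)

lemma composable_ginv: "b \<in> arrows G \<Longrightarrow> (b, ginv G b) \<in> composable G"
  by (simp add: composable_def ginv_closed rng_ginv)

lemma composable_ginv': "b \<in> arrows G \<Longrightarrow> (ginv G b, b) \<in> composable G"
  by (simp add: composable_def ginv_closed src_ginv)

lemma rng_closed: "b \<in> arrows G \<Longrightarrow> rng G b \<in> arrows G"
  unfolding rng_def by (rule gmult_closed[OF composable_ginv])

lemma rng_in_units: "b \<in> arrows G \<Longrightarrow> rng G b \<in> units G"
  by (simp add: units_def)

lemma src_in_units: "b \<in> arrows G \<Longrightarrow> src G b \<in> units G"
  using rng_in_units[OF ginv_closed] by (simp add: rng_ginv)

lemma units_subset: "units G \<subseteq> arrows G"
  by (auto simp: units_def rng_closed)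

lemma topspace_unit_space: "topspace (unit_space G) = units G"
  using units_subset by (auto simp: unit_space_def)

lemma gmult_ginv_gmult:
  "\<lbrakk>b \<in> arrows G; a \<in> arrows G; rng G b = rng G a\<rbrakk>
    \<Longrightarrow> gmult G b (gmult G (ginv G b) a) = a"
  using left_cancel[of "ginv G b" a] by (simp add: composable_def ginv_closed src_ginv ginv_ginv)

lemma bis_inv_bis_inv: "B \<subseteq> arrows G \<Longrightarrow> bis_inv G (bis_inv G B) = B"
  unfolding bis_inv_def image_image by (force simp: ginv_ginv image_iff)

lemma theta_src:
  assumes "inj_on (src G) B" "b \<in> B"
  shows "theta G B (src G b) = rng G b"
  using assms by (simp add: theta_def the_inv_into_f_f)

text \<open>Inversion swaps range and source, so this is \<open>theta_src\<close> for the inverse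
  bisection and the arrow \<open>ginv G b\<close>.\<close>

lemma theta_bis_inv_rng:
  assumes "inj_on (rng G) B" "b \<in> B" "B \<subseteq> arrows G"
  shows "theta G (bis_inv G B) (rng G b) = src G b"
proof -
  have "inj_on (src G) (bis_inv G B)"
    using assms(1,3) by (auto simp: inj_on_def bis_inv_def src_ginv subset_iff)
  moreover have "ginv G b \<in> bis_inv G B"
    using assms by (simp add: bis_inv_def)
  ultimately have "theta G (bis_inv G B) (src G (ginv G b)) = rng G (ginv G b)"
    by (rule theta_src)
  then show ?thesis using assms by (simp add: src_ginv rng_ginv subset_iff)
qed

text \<open>The action of the inverse bisection transports \<open>f\<close> to the sources, with
  value \<open>f (rng G b)\<close> at \<open>src G b\<close>. There it is multiplied by
  \<open>g\<close>, and the action of \<open>B\<close> transports the product back. Coefficients of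
  products are evaluated through this formula.\<close>

lemma action_product_rng:
  assumes "inj_on (rng G) B" "inj_on (src G) B" "b \<in> B" "B \<subseteq> arrows G"
  shows "action G B (\<lambda>y. action G (bis_inv G B) f y * g y) (rng G b) = f (rng G b) * g (src G b)"
proof -
  have "src G b \<in> rng G ` bis_inv G B"
    using assms rng_ginv[of b] by (force simp: bis_inv_def)
  then show ?thesis
    using assms by (simp add: action_def theta_bis_inv_rng theta_src bis_inv_bis_inv)
qed

text \<open>The product has the range of its first factor, which determines that factor within
  \<open>B\<close>; cancelling it leaves the second.\<close>

lemma composable_factor_unique:
  assumes B: "inj_on (rng G) B" and bc: "(b, c) \<in> composable G" "(b', c') \<in> composable G"
    and eq: "gmult G b c = gmult G b' c'" and bB: "b \<in> B" "b' \<in> B"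
  shows "b = b' \<and> c = c'"
proof -
  have "rng G b = rng G b'" using rng_gmult bc eq by metis
  then have "b = b'" using B bB by (simp add: inj_on_def)
  then show ?thesis using left_cancel bc eq by metis
qed

end

lemma compact_bisectionsD:
  assumes "B \<in> compact_bisections G"
  shows "openin (gtop G) B" "compactin (gtop G) B" "inj_on (rng G) B" "inj_on (src G) B"
    "B \<subseteq> arrows G"
  using assms by (auto simp: compact_bisections_def bisection_def dest: openin_subset)

section \<open>Continuity of the range and source maps\<close>

context topological_groupoid
begin

lemma continuous_map_gmult:
  assumes "continuous_map X (gtop G) f" "continuous_map X (gtop G) g"
    and "\<And>x. x \<in> topspace X \<Longrightarrow> (f x, g x) \<in> composable G"
  shows "continuous_map X (gtop G) (\<lambda>x. gmult G (f x) (g x))"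
proof -
  have "continuous_map X (subtopology (prod_topology (gtop G) (gtop G)) (composable G))
      (\<lambda>x. (f x, g x))"
    using assms by (auto simp: continuous_map_in_subtopology continuous_map_pairedI)
  from continuous_map_compose[OF this continuous_gmult] show ?thesis
    by (simp add: o_def)
qed

lemma continuous_rng: "continuous_map (gtop G) (unit_space G) (rng G)"
  unfolding unit_space_def continuous_map_in_subtopology
proof
  show "continuous_map (gtop G) (gtop G) (rng G)"
    unfolding rng_def[abs_def]
    by (rule continuous_map_gmult) (auto simp: continuous_ginv composable_ginv)
qed (auto simp: rng_in_units)

lemma continuous_src: "continuous_map (gtop G) (unit_space G) (src G)"
  unfolding unit_space_def continuous_map_in_subtopology
proof
  show "continuous_map (gtop G) (gtop G) (src G)"
    unfolding src_def[abs_def]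
    by (rule continuous_map_gmult) (auto simp: continuous_ginv composable_ginv')
qed (auto simp: src_in_units)

end

section \<open>Openness of the range map and products of compact bisections\<close>

context etale_groupoid
begin

text \<open>Around each point of \<open>U\<close> there is an open \<open>V\<close> that the range
  map sends homeomorphically onto an open set, so the image of \<open>V \<inter> U\<close> is
  open.\<close>

lemma openin_rng_image:
  assumes U: "openin (gtop G) U"
  shows "openin (unit_space G) (rng G ` U)"
proof (subst openin_subopen, safe)
  fix b assume b: "b \<in> U"
  then obtain V where V: "openin (gtop G) V" "b \<in> V" "openin (unit_space G) (rng G ` V)"
      "homeomorphic_map (subtopology (gtop G) V) (subtopology (unit_space G) (rng G ` V)) (rng G)"
    using local_homeomorphism_rng openin_subset[OF U] unfolding local_homeomorphism_def by blast
  have "openin (subtopology (gtop G) V) (V \<inter> U)"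
    using U by (simp add: openin_subtopology_Int2)
  then have "openin (subtopology (unit_space G) (rng G ` V)) (rng G ` (V \<inter> U))"
    using V(4) by (metis homeomorphic_imp_open_map open_map_def)
  then have "openin (unit_space G) (rng G ` (V \<inter> U))"
    using V(3) openin_trans_full by blast
  then show "\<exists>T. openin (unit_space G) T \<and> rng G b \<in> T \<and> T \<subseteq> rng G ` U"
    using b V(2) by (intro exI[of _ "rng G ` (V \<inter> U)"]) auto
qed

text \<open>The preimage of an open \<open>U\<close> under the section is the range image of
  \<open>B \<inter> U\<close>, which is open because the range map is open.\<close>

lemma continuous_rng_section:
  assumes B: "openin (gtop G) B" "inj_on (rng G) B"
  shows "continuous_map (subtopology (unit_space G) (rng G ` B)) (gtop G) (the_inv_into B (rng G))"
  unfolding continuous_map_def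
proof (intro conjI allI impI)
  have sub: "rng G ` B \<subseteq> units G"
    using openin_subset[OF B(1)] by (auto simp: rng_in_units)
  show "the_inv_into B (rng G) \<in> topspace (subtopology (unit_space G) (rng G ` B)) \<rightarrow> arrows G"
    using B openin_subset[OF B(1)] by (auto simp: the_inv_into_f_f)
  fix U assume U: "openin (gtop G) U"
  have "{x \<in> topspace (subtopology (unit_space G) (rng G ` B)). the_inv_into B (rng G) x \<in> U}
      = rng G ` (B \<inter> U)"
    using B(2) sub by (auto simp: the_inv_into_f_f topspace_unit_space)
  moreover have "openin (unit_space G) (rng G ` (B \<inter> U))"
    using B U by (intro openin_rng_image) auto
  ultimately show "openin (subtopology (unit_space G) (rng G ` B))
      {x \<in> topspace (subtopology (unit_space G) (rng G ` B)). the_inv_into B (rng G) x \<in> U}"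
    by (metis Int_lower1 image_mono openin_open_subtopology openin_rng_image B(1))
qed

lemma compactin_rng_image: "compactin (gtop G) B \<Longrightarrow> compactin (unit_space G) (rng G ` B)"
  using image_compactin continuous_rng by blast

lemma closedin_rng_image: "compactin (gtop G) B \<Longrightarrow> closedin (unit_space G) (rng G ` B)"
  using compactin_rng_image compactin_imp_closedin Hausdorff_unit_space by blast

text \<open>The only candidate for a first factor of \<open>a\<close> is the arrow \<open>b\<close>
  of \<open>B\<close> with the same range, and then the second factor must be
  \<open>gmult G (ginv G b) a\<close>. In this form the product set is a preimage of
  \<open>C\<close>.\<close>

lemma bis_mult_eq:
  assumes B: "inj_on (rng G) B" "B \<subseteq> arrows G" and C: "C \<subseteq> arrows G"
  shows "bis_mult G B C = {a \<in> arrows G. rng G a \<in> rng G ` B \<and>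
    gmult G (ginv G (the_inv_into B (rng G) (rng G a))) a \<in> C}" (is "_ = ?R")
proof
  show "bis_mult G B C \<subseteq> ?R"
  proof
    fix a assume "a \<in> bis_mult G B C"
    then obtain b c where a: "a = gmult G b c" "b \<in> B" "c \<in> C" "(b, c) \<in> composable G"
      using B C by (auto simp: bis_mult_def composable_def)
    then show "a \<in> ?R"
      using gmult_closed rng_gmult left_cancel B by (simp add: the_inv_into_f_f)
  qed
  show "?R \<subseteq> bis_mult G B C"
  proof
    fix a assume a: "a \<in> ?R"
    then obtain b where b: "b \<in> B" "rng G a = rng G b" by auto
    have c: "gmult G (ginv G b) a \<in> C"
      using a b B by (simp add: the_inv_into_f_f)
    have comp: "(ginv G b, a) \<in> composable G"
      using a b B by (auto simp: composable_def ginv_closed src_ginv)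
    then have "src G b = rng G (gmult G (ginv G b) a)"
      using rng_gmult[OF comp] b B by (auto simp: rng_ginv)
    moreover have "a = gmult G b (gmult G (ginv G b) a)"
      using gmult_ginv_gmult[of b a] a b B by auto
    ultimately show "a \<in> bis_mult G B C"
      using b c unfolding bis_mult_def by blast
  qed
qed

lemma openin_bis_mult:
  assumes B: "openin (gtop G) B" "inj_on (rng G) B" and C: "openin (gtop G) C"
  shows "openin (gtop G) (bis_mult G B C)"
proof -
  \<comment> \<open>\<open>W\<close> is the open set of arrows having a candidate first factor in
    \<open>B\<close>, and \<open>k\<close> gives the candidate second factor. The product set is the
    preimage of \<open>C\<close> under \<open>k\<close>, which is continuous on
    \<open>W\<close>.\<close>
  define W where "W = {a \<in> arrows G. rng G a \<in> rng G ` B}"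
  define k where "k a = gmult G (ginv G (the_inv_into B (rng G) (rng G a))) a" for a
  have W: "openin (gtop G) W"
    using continuous_rng openin_rng_image[OF B(1)] by (simp add: W_def continuous_map_def)
  then have topW: "topspace (subtopology (gtop G) W) = W"
    using openin_subset by fastforce
  have BA: "B \<subseteq> arrows G" using B(1) openin_subset by blast
  have rW: "continuous_map (subtopology (gtop G) W) (subtopology (unit_space G) (rng G ` B)) (rng G)"
    using continuous_rng
    by (auto simp: continuous_map_in_subtopology continuous_map_from_subtopology W_def)
  have "continuous_map (subtopology (gtop G) W) (gtop G)
      (\<lambda>a. ginv G (the_inv_into B (rng G) (rng G a)))"
    using continuous_map_compose[OF continuous_map_compose[OF rW continuous_rng_section[OF B]]
        continuous_ginv]
    by (simp add: o_def)
  then have "continuous_map (subtopology (gtop G) W) (gtop G) k"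
    unfolding k_def
  proof (rule continuous_map_gmult)
    show "continuous_map (subtopology (gtop G) W) (gtop G) (\<lambda>x. x)"
      using continuous_map_from_subtopology[OF continuous_map_id] by (simp add: id_def)
    fix a assume "a \<in> topspace (subtopology (gtop G) W)"
    then obtain b where "a \<in> arrows G" "b \<in> B" "rng G a = rng G b"
      by (auto simp: W_def)
    then show "(ginv G (the_inv_into B (rng G) (rng G a)), a) \<in> composable G"
      using B BA by (auto simp: the_inv_into_f_f composable_def ginv_closed src_ginv)
  qed
  then have "openin (subtopology (gtop G) W) {a \<in> W. k a \<in> C}"
    using C topW unfolding continuous_map_def by metis
  moreover have "{a \<in> W. k a \<in> C} = bis_mult G B C"
    using bis_mult_eq[OF B(2) BA openin_subset[OF C]] by (auto simp: W_def k_def)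
  ultimately show ?thesis
    using W openin_trans_full by fastforce
qed

text \<open>Composable pairs form the equalizer of two continuous maps into the Hausdorff unit
  space, hence a closed set. Those in \<open>B \<times> C\<close> form a compact set, which
  multiplication maps continuously onto the product set.\<close>

lemma compactin_bis_mult:
  assumes B: "compactin (gtop G) B" and C: "compactin (gtop G) C"
  shows "compactin (gtop G) (bis_mult G B C)"
proof -
  let ?P = "prod_topology (gtop G) (gtop G)"
  have BC: "B \<subseteq> arrows G" "C \<subseteq> arrows G"
    using B C compactin_subset_topspace by auto
  have "closedin ?P {p \<in> topspace ?P. (src G \<circ> fst) p = (rng G \<circ> snd) p}"
    using Hausdorff_unit_space
    by (intro closedin_continuous_maps_eq[of "unit_space G"]
        continuous_map_compose[OF continuous_map_fst continuous_src]
        continuous_map_compose[OF continuous_map_snd continuous_rng])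
  moreover have "{p \<in> topspace ?P. (src G \<circ> fst) p = (rng G \<circ> snd) p} = composable G"
    by (auto simp: composable_def)
  ultimately have "compactin ?P ((B \<times> C) \<inter> composable G)"
    using B C by (intro compact_Int_closedin) (auto simp: compactin_Times)
  then have "compactin (subtopology ?P (composable G)) ((B \<times> C) \<inter> composable G)"
    by (simp add: compactin_subtopology)
  from image_compactin[OF this continuous_gmult]
  have "compactin (gtop G) ((\<lambda>(b, c). gmult G b c) ` ((B \<times> C) \<inter> composable G))" .
  moreover have "(\<lambda>(b, c). gmult G b c) ` ((B \<times> C) \<inter> composable G) = bis_mult G B C"
    using BC by (force simp: bis_mult_def composable_def)
  ultimately show ?thesis by simp
qed

text \<open>For injectivity: the range of a product determines the first factor in \<open>B\<close>,
  whose source determines the second factor in \<open>C\<close>. The source map is treated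
  symmetrically.\<close>

lemma bis_mult_compact_bisections:
  assumes B: "B \<in> compact_bisections G" and C: "C \<in> compact_bisections G"
  shows "bis_mult G B C \<in> compact_bisections G"
proof -
  note b = compact_bisectionsD[OF B] and c = compact_bisectionsD[OF C]
  have *: "\<exists>b c. a = gmult G b c \<and> b \<in> B \<and> c \<in> C \<and> src G b = rng G c \<and>
      rng G a = rng G b \<and> src G a = src G c" if "a \<in> bis_mult G B C" for a
  proof -
    obtain b c where bc: "a = gmult G b c" "b \<in> B" "c \<in> C" "src G b = rng G c"
      using \<open>a \<in> bis_mult G B C\<close> by (auto simp: bis_mult_def)
    moreover have "(b, c) \<in> composable G"
      using bc b(5) c(5) by (auto simp: composable_def)
    ultimately show ?thesis
      using rng_gmult src_gmult by blast
  qed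
  have "inj_on (rng G) (bis_mult G B C)"
  proof (rule inj_onI)
    fix a a' assume "a \<in> bis_mult G B C" "a' \<in> bis_mult G B C" "rng G a = rng G a'"
    then show "a = a'" using * b(3) c(3) unfolding inj_on_def by metis
  qed
  moreover have "inj_on (src G) (bis_mult G B C)"
  proof (rule inj_onI)
    fix a a' assume "a \<in> bis_mult G B C" "a' \<in> bis_mult G B C" "src G a = src G a'"
    then show "a = a'" using * b(4) c(4) unfolding inj_on_def by metis
  qed
  ultimately show ?thesis
    using openin_bis_mult[OF b(1,3) c(1)] compactin_bis_mult[OF b(2) c(2)]
    by (simp add: compact_bisections_def bisection_def)
qed

lemma action_product_action_dom:
  assumes B: "B \<in> compact_bisections G" and C: "C \<in> compact_bisections G"
    and f: "f \<in> action_dom G B" and g: "g \<in> action_dom G C"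
  shows "action G B (\<lambda>y. action G (bis_inv G B) f y * g y) \<in> action_dom G (bis_mult G B C)"
    (is "?h \<in> _")
proof -
  note b = compact_bisectionsD[OF B]
  let ?s = "the_inv_into B (rng G)"
  \<comment> \<open>Written through the section of the range map, the coefficient is visibly locally
    constant on the clopen set of ranges of \<open>B\<close>, and extension by zero preserves
    this.\<close>
  have h: "?h = (\<lambda>x. if x \<in> rng G ` B then f x * g (src G (?s x)) else 0)"
  proof
    fix x show "?h x = (if x \<in> rng G ` B then f x * g (src G (?s x)) else 0)"
    proof (cases "x \<in> rng G ` B")
      case True
      then obtain b where "b \<in> B" "x = rng G b" by auto
      then show ?thesis
        using b by (simp add: action_product_rng the_inv_into_f_f)
    qed (simp add: action_def)
  qed
  have "locally_constant (unit_space G) f" "locally_constant (unit_space G) g"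
    using f g by (auto simp: action_dom_def loc_const_fun_locally_constant)
  then have "locally_constant (subtopology (unit_space G) (rng G ` B)) (\<lambda>x. f x * g (src G (?s x)))"
    using locally_constant_compose[OF continuous_map_compose[OF continuous_rng_section[OF b(1,3)]
          continuous_src]]
    by (intro locally_constant_comp2[where h = "(*)"]) (simp_all add: o_def locally_constant_subtopology)
  then have "locally_constant (unit_space G) ?h"
    unfolding h using b
    by (intro locally_constant_extend openin_rng_image closedin_rng_image)
  then have "?h \<in> loc_const_fun (unit_space G)"
    by (rule loc_const_funI[OF _ compactin_rng_image[OF b(2)]]) (simp add: h)
  moreover have "?h x = 0" if x: "x \<in> units G - rng G ` bis_mult G B C" for x
  proof (cases "x \<in> rng G ` B")
    case True
    then obtain b where b': "b \<in> B" "x = rng G b" by auto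
    \<comment> \<open>Otherwise some \<open>gmult G b c\<close> would lie in the product set and
      have range \<open>x\<close>. Hence the factor \<open>g\<close> vanishes at the source of
      \<open>b\<close>.\<close>
    have "src G b \<notin> rng G ` C"
    proof
      assume "src G b \<in> rng G ` C"
      then obtain c where c: "c \<in> C" "src G b = rng G c" by auto
      then have "gmult G b c \<in> bis_mult G B C" using b' by (auto simp: bis_mult_def)
      moreover have "rng G (gmult G b c) = rng G b"
        using c b'(1) b(5) compact_bisectionsD(5)[OF C] by (intro rng_gmult) (auto simp: composable_def)
      ultimately show False using x b' by (metis DiffE image_eqI)
    qed
    then have "g (src G b) = 0"
      using g src_in_units b'(1) b(5) by (auto simp: action_dom_def)
    then show ?thesis using b b' by (simp add: action_product_rng)
  qed (simp add: h)
  ultimately show ?thesis by (simp add: action_dom_def)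
qed

end


section \<open>From formal sums to functions on the groupoid\<close>

definition bis_fun :: "'g groupoid_data \<Rightarrow> 'g set \<Rightarrow> ('g \<Rightarrow> 'r::zero) \<Rightarrow> 'g \<Rightarrow> 'r" where
  "bis_fun G B f b = (if b \<in> B then f (rng G b) else 0)"

definition realize ::
    "'g groupoid_data \<Rightarrow> ('g set \<Rightarrow> 'g \<Rightarrow> 'r::comm_monoid_add) \<Rightarrow> 'g \<Rightarrow> 'r" where
  "realize G F b = (\<Sum>B\<in>fsupp F. bis_fun G B (F B) b)"

text \<open>Supports can shrink under addition and scaling, so sums are compared over a common
  finite set containing them; the additional terms have zero coefficient.\<close>

lemma realize_superset:
  assumes "finite S" "fsupp F \<subseteq> S"
  shows "realize G F b = (\<Sum>B\<in>S. bis_fun G B (F B) b)"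
  unfolding realize_def using assms
  by (intro sum.mono_neutral_left) (auto simp: fsupp_def bis_fun_def)

lemma fsupp_add: "fsupp (\<lambda>B x. F B x + H B x :: 'r::comm_monoid_add) \<subseteq> fsupp F \<union> fsupp H"
  by (auto simp: fsupp_def)

lemma fsupp_scale: "fsupp (\<lambda>B x. c * F B x :: 'r::mult_zero) \<subseteq> fsupp F"
  by (auto simp: fsupp_def)

lemma fsupp_single: "fsupp (single B f) \<subseteq> {B}"
  by (auto simp: fsupp_def single_def)

lemma realize_add:
  assumes "finite (fsupp F)" "finite (fsupp H)"
  shows "realize G (\<lambda>B x. F B x + H B x) = (\<lambda>b. realize G F b + realize G H b)"
proof
  fix b
  let ?S = "fsupp F \<union> fsupp H"
  have "finite ?S" using assms by simp
  then show "realize G (\<lambda>B x. F B x + H B x) b = realize G F b + realize G H b"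
    using fsupp_add[of F H]
    by (simp add: realize_superset[of ?S] sum.distrib[symmetric])
      (rule sum.cong, auto simp: bis_fun_def)
qed

lemma realize_scale:
  fixes F :: "'g set \<Rightarrow> 'g \<Rightarrow> 'r::comm_semiring_0"
  assumes "finite (fsupp F)"
  shows "realize G (\<lambda>B x. c * F B x) = (\<lambda>b. c * realize G F b)"
  using assms fsupp_scale[of c F]
  by (intro ext, simp add: realize_superset[of "fsupp F"] sum_distrib_left)
    (rule sum.cong, auto simp: bis_fun_def)

lemma realize_zero: "realize G (\<lambda>_ _. 0) = (\<lambda>b. 0)"
  by (simp add: realize_def[abs_def] fsupp_def)

lemma realize_single: "realize G (single B f) b = bis_fun G B f b"
  using fsupp_single[of B f] by (simp add: realize_superset[of "{B}"] single_def)

section \<open>Formal sums as a module\<close>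

lemma action_dom_zero: "(\<lambda>x. 0) \<in> action_dom G B"
  by (simp add: action_dom_def loc_const_fun_zero)

lemma action_dom_add:
  "\<lbrakk>f \<in> action_dom G B; g \<in> action_dom G B\<rbrakk> \<Longrightarrow> (\<lambda>x. f x + g x) \<in> action_dom G B"
  by (simp add: action_dom_def loc_const_fun_add)

lemma action_dom_scale: "f \<in> action_dom G B \<Longrightarrow> (\<lambda>x. c * f x) \<in> action_dom G B"
  by (simp add: action_dom_def loc_const_fun_scale)

lemma formal_alg_simps:
  "azero (formal_alg G) = (\<lambda>_ _. 0)"
  "aadd (formal_alg G) = (\<lambda>F H B x. F B x + H B x)"
  "amult (formal_alg G) = formal_mult G"
  "ascale (formal_alg G) = (\<lambda>c F B x. c * F B x)"
  by (simp_all add: formal_alg_def)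

lemma formal_carrier_iff:
  "F \<in> acarrier (formal_alg G) \<longleftrightarrow> finite (fsupp F) \<and> fsupp F \<subseteq> compact_bisections G \<and>
    (\<forall>B \<in> compact_bisections G. F B \<in> action_dom G B)"
  by (simp add: formal_alg_def)

lemma formal_carrier_finite: "F \<in> acarrier (formal_alg G) \<Longrightarrow> finite (fsupp F)"
  by (simp add: formal_carrier_iff)

lemma formal_carrier_zero: "(\<lambda>_ _. 0) \<in> acarrier (formal_alg G)"
  by (simp add: formal_carrier_iff fsupp_def action_dom_zero)

lemma formal_carrier_add:
  assumes "F \<in> acarrier (formal_alg G)" "H \<in> acarrier (formal_alg G)"
  shows "(\<lambda>B x. F B x + H B x) \<in> acarrier (formal_alg G)"
  using assms fsupp_add[of F H] finite_subset[OF fsupp_add[of F H]]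
  by (auto simp: formal_carrier_iff intro: action_dom_add)

lemma formal_carrier_scale:
  assumes "F \<in> acarrier (formal_alg G)"
  shows "(\<lambda>B x. c * F B x) \<in> acarrier (formal_alg G)"
  using assms fsupp_scale[of c F] finite_subset[OF fsupp_scale[of c F]]
  by (auto simp: formal_carrier_iff intro: action_dom_scale)

lemma formal_carrier_sum:
  "(\<And>i. i \<in> I \<Longrightarrow> F i \<in> acarrier (formal_alg G)) \<Longrightarrow>
    (\<lambda>B x. \<Sum>i\<in>I. F i B x) \<in> acarrier (formal_alg G)"
  by (induction I rule: infinite_finite_induct)
    (auto simp: formal_carrier_zero formal_carrier_add)

lemma formal_carrier_single:
  "\<lbrakk>B \<in> compact_bisections G; f \<in> action_dom G B\<rbrakk> \<Longrightarrow> single B f \<in> acarrier (formal_alg G)"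
  using fsupp_single[of B f] finite_subset[OF fsupp_single[of B f]]
  by (auto simp: formal_carrier_iff single_def action_dom_zero)

lemma realize_sum:
  assumes "\<And>i. i \<in> I \<Longrightarrow> F i \<in> acarrier (formal_alg G)"
  shows "realize G (\<lambda>B x. \<Sum>i\<in>I. F i B x) b = (\<Sum>i\<in>I. realize G (F i) b)"
  using assms
proof (induction I rule: infinite_finite_induct)
  case (insert i I)
  then have "finite (fsupp (F i))" "finite (fsupp (\<lambda>B x. \<Sum>i\<in>I. F i B x))"
    using formal_carrier_sum[of I F G] by (auto simp: formal_carrier_iff)
  with insert show ?case by (simp add: realize_add)
qed (simp_all add: realize_zero)

lemma two_sided_ideal_sum:
  assumes "two_sided_ideal (formal_alg G) J" "\<And>i. i \<in> I \<Longrightarrow> F i \<in> J"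
  shows "(\<lambda>B x. \<Sum>i\<in>I. F i B x) \<in> J"
  using assms(2)
proof (induction I rule: infinite_finite_induct)
  case (insert i I)
  then have "F i \<in> J" "(\<lambda>B x. \<Sum>i\<in>I. F i B x) \<in> J" by auto
  then have "aadd (formal_alg G) (F i) (\<lambda>B x. \<Sum>i\<in>I. F i B x) \<in> J"
    using assms(1) unfolding two_sided_ideal_def by blast
  then show ?case using insert by (simp add: formal_alg_simps)
qed (use assms(1) in \<open>simp_all add: two_sided_ideal_def formal_alg_simps\<close>)

section \<open>Surjectivity onto the Steinberg algebra\<close>

locale ample_Hausdorff_groupoid = ample_groupoid +
  assumes Hausdorff_gtop: "Hausdorff_space (gtop G)"
begin

text \<open>Here the Hausdorff property of the whole groupoid enters: it makes compact bisections
  clopen.\<close>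

lemma compact_bisections_closedin: "B \<in> compact_bisections G \<Longrightarrow> closedin (gtop G) B"
  using compact_bisectionsD(2) compactin_imp_closedin Hausdorff_gtop by blast

lemma compact_bisections_subset:
  assumes "B \<in> compact_bisections G" "A \<subseteq> B" "openin (gtop G) A" "closedin (gtop G) A"
  shows "A \<in> compact_bisections G"
  using assms closed_compactin
  by (auto simp: compact_bisections_def bisection_def intro: inj_on_subset)

lemma Union_compact_bisections: "\<Union> (compact_bisections G) = arrows G"
proof -
  have "(arbitrary union_of (\<lambda>B. B \<in> compact_bisections G)) (arrows G)"
    by (simp add: compact_bisections_basis[symmetric])
  then obtain \<U> where "\<U> \<subseteq> compact_bisections G" "\<Union> \<U> = arrows G"
    by (auto simp: union_of_def)
  then have "arrows G \<subseteq> \<Union> (compact_bisections G)"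
    by blast
  then show ?thesis using compact_bisectionsD(5) by blast
qed

lemma bis_fun_loc_const_fun:
  assumes B: "B \<in> compact_bisections G" and f: "f \<in> loc_const_fun (unit_space G)"
  shows "bis_fun G B f \<in> loc_const_fun (gtop G)"
proof (rule loc_const_funI)
  show "locally_constant (gtop G) (bis_fun G B f)"
    unfolding bis_fun_def[abs_def]
    using B f by (intro locally_constant_extend locally_constant_subtopology
        locally_constant_compose[OF continuous_rng])
      (auto simp: compact_bisections_closedin compact_bisectionsD loc_const_fun_locally_constant)
  show "compactin (gtop G) B" using B by (rule compact_bisectionsD)
qed (simp add: bis_fun_def)

text \<open>The coefficient is \<open>f\<close> composed with the section of the range map over
  \<open>B\<close>, extended by zero off the clopen set of ranges.\<close>

lemma bis_fun_surj:
  assumes B: "B \<in> compact_bisections G" and f: "f \<in> loc_const_fun (gtop G)"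
    and vanish: "\<And>b. b \<notin> B \<Longrightarrow> f b = 0"
  shows "\<exists>g \<in> action_dom G B. bis_fun G B g = f"
proof
  note b = compact_bisectionsD[OF B]
  let ?g = "\<lambda>x. if x \<in> rng G ` B then f (the_inv_into B (rng G) x) else 0"
  show "bis_fun G B ?g = f"
    using b vanish by (auto simp: bis_fun_def fun_eq_iff the_inv_into_f_f)
  have "locally_constant (unit_space G) ?g"
    using b f by (intro locally_constant_extend openin_rng_image closedin_rng_image
        locally_constant_compose[OF continuous_rng_section]) (auto simp: loc_const_fun_locally_constant)
  then have "?g \<in> loc_const_fun (unit_space G)"
    by (rule loc_const_funI[OF _ compactin_rng_image[OF b(2)]]) simp
  then show "?g \<in> action_dom G B" by (simp add: action_dom_def)
qed

lemma realize_loc_const_fun: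
  assumes "F \<in> acarrier (formal_alg G)"
  shows "realize G F \<in> loc_const_fun (gtop G)"
  unfolding realize_def[abs_def]
  using assms by (intro loc_const_fun_sum bis_fun_loc_const_fun)
    (auto simp: formal_carrier_iff action_dom_def)

text \<open>Induction on a finite cover of the support: the part of \<open>f\<close> on
  \<open>B\<close> is a single term, and the rest is supported in the remaining bisections. No
  disjointness of the cover is assumed, since each step removes \<open>B\<close> from the
  support.\<close>

lemma realize_surj_aux:
  assumes "finite \<B>" "\<B> \<subseteq> compact_bisections G" "f \<in> loc_const_fun (gtop G)"
    and "\<And>b. b \<notin> \<Union> \<B> \<Longrightarrow> f b = 0"
  shows "f \<in> realize G ` acarrier (formal_alg G)"
  using assms
proof (induction \<B> arbitrary: f rule: finite_induct)
  case empty
  then have "f = realize G (\<lambda>_ _. 0)" by (auto simp: realize_zero)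
  then show ?case using formal_carrier_zero by blast
next
  case (insert B \<B>)
  have B: "B \<in> compact_bisections G" using insert.prems by simp
  have op: "openin (gtop G) B" "openin (gtop G) (arrows G - B)"
    and cl: "closedin (gtop G) B" "closedin (gtop G) (arrows G - B)"
    using B compact_bisectionsD compact_bisections_closedin by auto
  let ?f1 = "\<lambda>b. if b \<in> B then f b else 0"
  \<comment> \<open>Restricting to \<open>arrows G - B\<close> keeps the set clopen; outside the
    arrows \<open>f\<close> is zero anyway.\<close>
  let ?f2 = "\<lambda>b. if b \<in> arrows G - B then f b else 0"
  have f2: "?f2 \<in> loc_const_fun (gtop G)"
    using insert.prems(2) op(2) cl(2) by (rule loc_const_fun_restrict)
  have "?f2 b = 0" if "b \<notin> \<Union> \<B>" for b
    using that insert.prems(3)[of b] by auto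
  with insert.IH[OF _ f2] insert.prems obtain F
    where F: "F \<in> acarrier (formal_alg G)" "?f2 = realize G F" by auto
  have "?f1 \<in> loc_const_fun (gtop G)"
    using insert.prems(2) op(1) cl(1) by (rule loc_const_fun_restrict)
  from bis_fun_surj[OF B this] obtain g where g: "g \<in> action_dom G B" "bis_fun G B g = ?f1"
    by auto
  have single: "single B g \<in> acarrier (formal_alg G)"
    using B g(1) by (rule formal_carrier_single)
  have "realize G (\<lambda>C x. single B g C x + F C x) b = f b" for b
  proof -
    have "realize G (\<lambda>C x. single B g C x + F C x) b = ?f1 b + ?f2 b"
      using F single by (subst realize_add) (auto simp: formal_carrier_finite realize_single g(2) F(2)[symmetric])
    moreover have "f b = 0" if "b \<notin> arrows G"
      using that insert.prems(2) by (simp add: loc_const_fun_def)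
    ultimately show ?thesis by auto
  qed
  then have "f = realize G (\<lambda>C x. single B g C x + F C x)" by auto
  then show ?case using formal_carrier_add[OF single F(1)] by blast
qed

lemma realize_image:
  "realize G ` acarrier (formal_alg G)
    = (loc_const_fun (gtop G) :: ('a \<Rightarrow> 'r::{comm_ring, comm_monoid_mult}) set)"
    (is "?L = ?R")
proof
  show "?L \<subseteq> ?R"
    using realize_loc_const_fun by auto
  show "?R \<subseteq> ?L"
  proof
    fix f :: "'a \<Rightarrow> 'r" assume f: "f \<in> loc_const_fun (gtop G)"
    \<comment> \<open>Compactness of the support extracts a finite cover by compact
      bisections.\<close>
    have K: "compactin (gtop G) {b. f b \<noteq> 0}"
      using f by (rule loc_const_fun_compact_support)
    have "{b. f b \<noteq> 0} \<subseteq> \<Union> (compact_bisections G)"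
      using compactin_subset_topspace[OF K] by (simp add: Union_compact_bisections)
    then obtain \<B> where "finite \<B>" "\<B> \<subseteq> compact_bisections G" "{b. f b \<noteq> 0} \<subseteq> \<Union> \<B>"
      using K compact_bisectionsD(1) unfolding compactin_def by (metis (no_types, lifting))
    then show "f \<in> realize G ` acarrier (formal_alg G)"
      using f by (intro realize_surj_aux[of \<B>]) auto
  qed
qed

section \<open>Multiplication goes to convolution\<close>

lemma bis_fun_convolution:
  fixes f g :: "'a \<Rightarrow> 'r::{comm_ring, comm_monoid_mult}"
  assumes B: "B \<in> compact_bisections G" and C: "C \<in> compact_bisections G"
    and T: "finite T" "T \<subseteq> {(c, d) \<in> composable G. gmult G c d = a}"
      "{(c, d) \<in> composable G. gmult G c d = a} \<inter> B \<times> C \<subseteq> T"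
  shows "(\<Sum>(c, d)\<in>T. bis_fun G B f c * bis_fun G C g d) =
    bis_fun G (bis_mult G B C) (action G B (\<lambda>y. action G (bis_inv G B) f y * g y)) a"
proof -
  note b = compact_bisectionsD[OF B] and c = compact_bisectionsD[OF C]
  let ?P = "{(c, d) \<in> composable G. gmult G c d = a} \<inter> B \<times> C"
  \<comment> \<open>\<open>T\<close> may contain factorizations of \<open>a\<close> outside
    \<open>B \<times> C\<close>; they contribute zero. This lets one \<open>T\<close> serve for all
    pairs of bisections at once.\<close>
  have "(\<Sum>(c, d)\<in>T. bis_fun G B f c * bis_fun G C g d)
      = (\<Sum>(c, d)\<in>?P. bis_fun G B f c * bis_fun G C g d)"
    using T by (intro sum.mono_neutral_right) (auto simp: bis_fun_def split: if_splits)
  also have "\<dots> = bis_fun G (bis_mult G B C) (action G B (\<lambda>y. action G (bis_inv G B) f y * g y)) a"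
  proof (cases "a \<in> bis_mult G B C")
    case True
    then obtain x y where xy: "a = gmult G x y" "x \<in> B" "y \<in> C" "src G x = rng G y"
      by (auto simp: bis_mult_def)
    then have comp: "(x, y) \<in> composable G" using b c by (auto simp: composable_def)
    have "?P = {(x, y)}"
      using xy comp composable_factor_unique[OF b(3)] by blast
    then show ?thesis
      using True xy b rng_gmult[OF comp] by (simp add: bis_fun_def action_product_rng)
  next
    case False
    then have "?P = {}" by (fastforce simp: bis_mult_def composable_def)
    then show ?thesis using False by (simp add: bis_fun_def)
  qed
  finally show ?thesis .
qed

lemma finite_factorizations:
  assumes "B \<in> compact_bisections G"
  shows "finite ({(c, d) \<in> composable G. gmult G c d = a} \<inter> B \<times> C)" (is "finite ?P")
proof (cases "?P = {}")
  case False
  then obtain p where "p \<in> ?P" by blast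
  then have "?P \<subseteq> {p}"
    using composable_factor_unique[OF compact_bisectionsD(3)[OF assms]] by blast
  then show ?thesis using finite_subset by blast
qed simp

lemma formal_mult_summand:
  assumes "F \<in> acarrier (formal_alg G)" "H \<in> acarrier (formal_alg G)" "B \<in> fsupp F" "C \<in> fsupp H"
  shows "single (bis_mult G B C) (action G B (\<lambda>y. action G (bis_inv G B) (F B) y * H C y))
    \<in> acarrier (formal_alg G)"
  using assms by (intro formal_carrier_single bis_mult_compact_bisections action_product_action_dom)
    (auto simp: formal_carrier_iff)

lemma formal_mult_closed:
  assumes "F \<in> acarrier (formal_alg G)" "H \<in> acarrier (formal_alg G)"
  shows "formal_mult G F H \<in> acarrier (formal_alg G)"
  unfolding formal_mult_def using assms
  by (intro formal_carrier_sum formal_mult_summand)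

lemma realize_formal_mult:
  assumes F: "F \<in> acarrier (formal_alg G)" and H: "H \<in> acarrier (formal_alg G)"
  shows "realize G (formal_mult G F H) = convolution G (realize G F) (realize G H)"
proof
  fix a
  let ?P = "{(c, d) \<in> composable G. gmult G c d = a}"
  let ?T = "\<Union>B\<in>fsupp F. \<Union>C\<in>fsupp H. ?P \<inter> B \<times> C"
  \<comment> \<open>A finite union of sets with at most one element each.\<close>
  have fin: "finite ?T"
    using F H finite_factorizations unfolding formal_carrier_iff by blast
  \<comment> \<open>A pair outside \<open>?T\<close> has its first factor in no bisection of the
    support of \<open>F\<close>, or its second in none of the support of \<open>H\<close>, so its
    summand is zero.\<close>
  have "convolution G (realize G F) (realize G H) a
      = sum' (\<lambda>(c, d). realize G F c * realize G H d) ?T"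
    unfolding convolution_def
  proof (rule sum.mono_neutral_right')
    show "\<forall>p \<in> ?P - ?T. (case p of (c, d) \<Rightarrow> realize G F c * realize G H d) = 0"
    proof
      fix p assume p: "p \<in> ?P - ?T"
      obtain c d where cd: "p = (c, d)" by fastforce
      show "(case p of (c, d) \<Rightarrow> realize G F c * realize G H d) = 0"
      proof (cases "\<exists>B \<in> fsupp F. c \<in> B")
        case False
        then have "realize G F c = 0" by (auto simp: realize_def bis_fun_def)
        then show ?thesis by (simp add: cd)
      next
        case True
        then have "\<forall>C \<in> fsupp H. d \<notin> C" using p cd by auto
        then have "realize G H d = 0" by (simp add: realize_def bis_fun_def)
        then show ?thesis by (simp add: cd)
      qed
    qed
  qed auto
  also have "\<dots> = (\<Sum>(c, d)\<in>?T. realize G F c * realize G H d)"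
    using fin by (rule sum.eq_sum)
  also have "\<dots> = (\<Sum>p\<in>?T. \<Sum>B\<in>fsupp F. \<Sum>C\<in>fsupp H.
      case p of (c, d) \<Rightarrow> bis_fun G B (F B) c * bis_fun G C (H C) d)"
    by (rule sum.cong) (auto simp: realize_def sum_product)
  also have "\<dots> = (\<Sum>B\<in>fsupp F. \<Sum>C\<in>fsupp H. \<Sum>p\<in>?T.
      case p of (c, d) \<Rightarrow> bis_fun G B (F B) c * bis_fun G C (H C) d)"
    by (subst sum.swap) (intro sum.cong refl sum.swap)
  also have "\<dots> = (\<Sum>B\<in>fsupp F. \<Sum>C\<in>fsupp H. bis_fun G (bis_mult G B C)
      (action G B (\<lambda>y. action G (bis_inv G B) (F B) y * H C y)) a)"
    using F H fin by (intro sum.cong refl bis_fun_convolution) (auto simp: formal_carrier_iff)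
  also have "\<dots> = realize G (formal_mult G F H) a"
    unfolding formal_mult_def
    using F H by (simp add: realize_sum formal_carrier_sum formal_mult_summand realize_single)
  finally show "realize G (formal_mult G F H) a = convolution G (realize G F) (realize G H) a" ..
qed


section \<open>The kernel\<close>

lemma restrict_action_dom:
  assumes C: "C \<in> compact_bisections G" and f: "f \<in> action_dom G B"
  shows "(\<lambda>x. if x \<in> rng G ` C then f x else 0) \<in> action_dom G C"
  using f compact_bisectionsD[OF C]
    loc_const_fun_restrict[of f "unit_space G" "rng G ` C"]
  by (auto simp: action_dom_def openin_rng_image closedin_rng_image)

text \<open>A Boolean combination of finitely many clopen sets is clopen, and any member of the
  nonempty \<open>S\<close> is a compact bisection containing it.\<close>

lemma atom_compact_bisections:
  assumes \<B>: "finite \<B>" "\<B> \<subseteq> compact_bisections G" and S: "S \<subseteq> \<B>" "S \<noteq> {}"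
  shows "\<Inter> S - \<Union> (\<B> - S) \<in> compact_bisections G"
proof -
  have clopen: "openin (gtop G) B" "closedin (gtop G) B" if "B \<in> \<B>" for B
    using that \<B>(2) compact_bisectionsD(1) compact_bisections_closedin by auto
  have "openin (gtop G) (\<Inter> S)" "closedin (gtop G) (\<Inter> S)"
    using S finite_subset[OF S(1) \<B>(1)] clopen by (auto intro!: openin_Inter closedin_Inter)
  moreover have "openin (gtop G) (\<Union> (\<B> - S))" "closedin (gtop G) (\<Union> (\<B> - S))"
    using \<B>(1) clopen by (auto intro!: openin_Union closedin_Union)
  ultimately have "openin (gtop G) (\<Inter> S - \<Union> (\<B> - S))" "closedin (gtop G) (\<Inter> S - \<Union> (\<B> - S))"
    by (simp_all add: openin_diff closedin_diff)
  moreover obtain B where "B \<in> S" using S by blast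
  ultimately show ?thesis
    using \<B>(2) S(1) compact_bisections_subset[of B "\<Inter> S - \<Union> (\<B> - S)"] by blast
qed

text \<open>
  A formal sum in the kernel is rewritten, modulo the relations, as a sum over the atoms of the
  Boolean algebra generated by its support; the atoms are disjoint, so all its coefficients vanish.
\<close>

lemma kernel_subset_ideal:
  assumes F: "F \<in> acarrier (formal_alg G)" and ker: "\<And>b. realize G F b = 0"
    and J: "two_sided_ideal (formal_alg G) J" "skew_relations G \<subseteq> J"
  shows "F \<in> J"
proof -
  define \<B> where "\<B> = fsupp F"
  have \<B>: "finite \<B>" "\<B> \<subseteq> compact_bisections G" "\<And>B. B \<in> \<B> \<Longrightarrow> F B \<in> action_dom G B"
    using F by (auto simp: formal_carrier_iff \<B>_def)
  \<comment> \<open>\<open>E S\<close> is the atom of points whose containing members of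
    \<open>\<B>\<close> are exactly those in \<open>S\<close>. As \<open>\<Inter> {}\<close> is
    \<open>UNIV\<close>, it is treated as a compact bisection only when some
    \<open>B \<in> S\<close> is at hand.\<close>
  define E where "E S = \<Inter> S - \<Union> (\<B> - S)" for S
  define r where "r B S x = (if x \<in> rng G ` E S then F B x else 0)" for B S x
  have rel: "(\<lambda>A x. single (E S) (r B S) A x - single B (r B S) A x) \<in> J"
    if "B \<in> S" "S \<subseteq> \<B>" for B S
  proof -
    have "E S \<in> compact_bisections G" "E S \<subseteq> B" "B \<in> compact_bisections G"
      using that \<B> atom_compact_bisections[of \<B> S] by (auto simp: E_def)
    moreover have "r B S \<in> action_dom G (E S)"
      using that \<B> restrict_action_dom[OF \<open>E S \<in> compact_bisections G\<close>, of "F B" B]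
      by (auto simp: r_def[abs_def])
    ultimately show ?thesis
      using J(2) unfolding skew_relations_def by blast
  qed
  \<comment> \<open>The atoms \<open>E S\<close> with \<open>B \<in> S\<close> cover
    \<open>B\<close> disjointly, and so do their ranges in the range of \<open>B\<close>, by
    injectivity. The pieces of \<open>F B\<close> therefore add up to \<open>F B\<close>.\<close>
  have split: "(\<Sum>S | S \<in> Pow \<B> \<and> B \<in> S. r B S x) = F B x" if B: "B \<in> \<B>" for B x
  proof (cases "x \<in> rng G ` B")
    case True
    then obtain b where b: "b \<in> B" "x = rng G b" by auto
    have inj: "inj_on (rng G) B" using B \<B>(2) compact_bisectionsD(3) by blast
    have "x \<in> rng G ` E S \<longleftrightarrow> S = {C \<in> \<B>. b \<in> C}" if S: "S \<in> Pow \<B>" "B \<in> S" for S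
    proof -
      have "E S \<subseteq> B" using S by (auto simp: E_def)
      then have "x \<in> rng G ` E S \<longleftrightarrow> b \<in> E S"
        using b inj by (auto simp: inj_on_def)
      also have "\<dots> \<longleftrightarrow> S = {C \<in> \<B>. b \<in> C}"
        using S by (auto simp: E_def)
      finally show ?thesis .
    qed
    then have "(\<Sum>S | S \<in> Pow \<B> \<and> B \<in> S. r B S x)
        = (\<Sum>S | S \<in> Pow \<B> \<and> B \<in> S. if S = {C \<in> \<B>. b \<in> C} then F B x else 0)"
      by (intro sum.cong) (auto simp: r_def)
    then show ?thesis
      using B b \<B>(1) by (simp add: sum.delta)
  next
    case False
    then have "F B x = 0"
      using \<B>(3)[OF B] by (auto simp: action_dom_def loc_const_fun_def topspace_unit_space)
    then show ?thesis by (auto simp: r_def intro!: sum.neutral)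
  qed
  \<comment> \<open>On a fixed atom, the coefficients moved there add up at \<open>rng G b\<close>
    to the value of \<open>realize G F\<close> at \<open>b\<close>, which is zero.\<close>
  have vanish: "(\<Sum>B | B \<in> \<B> \<and> B \<in> S. single (E S) (r B S) A x) = 0" if S: "S \<subseteq> \<B>" for S A x
  proof (cases "A = E S \<and> x \<in> rng G ` E S")
    case True
    then obtain b where b: "b \<in> E S" "x = rng G b" by auto
    have "(\<Sum>B | B \<in> \<B> \<and> B \<in> S. single (E S) (r B S) A x) = (\<Sum>B | B \<in> \<B> \<and> B \<in> S. F B x)"
      using True by (simp add: single_def r_def)
    also have "\<dots> = (\<Sum>B | B \<in> \<B> \<and> B \<in> S. bis_fun G B (F B) b)"
      using b by (intro sum.cong) (auto simp: bis_fun_def E_def)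
    also have "\<dots> = (\<Sum>B\<in>\<B>. bis_fun G B (F B) b)"
      using b \<B>(1) by (intro sum.mono_neutral_left) (auto simp: bis_fun_def E_def)
    also have "\<dots> = 0"
      using ker[of b] by (simp add: realize_def \<B>_def)
    finally show ?thesis .
  next
    case False
    then show ?thesis
      by (intro sum.neutral ballI) (auto simp: single_def r_def)
  qed
  \<comment> \<open>Collecting all relations gives the sum over atoms minus \<open>F\<close>. The
    former is zero, so \<open>H\<close> is the negative of \<open>F\<close>.\<close>
  define H where "H A x = (\<Sum>B\<in>\<B>. \<Sum>S | S \<in> Pow \<B> \<and> B \<in> S.
    single (E S) (r B S) A x - single B (r B S) A x)" for A x
  have "H \<in> J"
    unfolding H_def[abs_def] using J(1) rel
    by (intro two_sided_ideal_sum[of G J]) auto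
  then have "ascale (formal_alg G) (- 1) H \<in> J"
    using J(1) unfolding two_sided_ideal_def by blast
  moreover have "ascale (formal_alg G) (- 1) H = F"
  proof (intro ext)
    fix A x
    \<comment> \<open>Exchanging the sums fixes the atom first, so that \<open>vanish\<close>
      applies to each inner sum.\<close>
    have "(\<Sum>B\<in>\<B>. \<Sum>S | S \<in> Pow \<B> \<and> B \<in> S. single (E S) (r B S) A x) = 0"
      using \<B>(1) by (subst sum.swap_restrict) (auto intro!: sum.neutral vanish)
    moreover have "(\<Sum>B\<in>\<B>. \<Sum>S | S \<in> Pow \<B> \<and> B \<in> S. single B (r B S) A x) = F A x"
    proof -
      have "(\<Sum>B\<in>\<B>. \<Sum>S | S \<in> Pow \<B> \<and> B \<in> S. single B (r B S) A x)
          = (\<Sum>B\<in>\<B>. if B = A then F B x else 0)"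
        using split by (intro sum.cong) (auto simp: single_def)
      also have "\<dots> = F A x"
        using \<B>(1) by (auto simp: sum.delta' \<B>_def fsupp_def)
      finally show ?thesis .
    qed
    ultimately show "ascale (formal_alg G) (- 1) H A x = F A x"
      by (simp add: formal_alg_simps H_def sum_subtractf)
  qed
  ultimately show ?thesis by simp
qed

section \<open>The generated ideal and the isomorphism\<close>

lemma convolution_zero: "convolution G (\<lambda>_. 0) f = (\<lambda>_. 0)" "convolution G f (\<lambda>_. 0) = (\<lambda>_. 0)"
  by (auto simp: convolution_def sum.G_def)

lemma kernel_ideal:
  "two_sided_ideal (formal_alg G) {F \<in> acarrier (formal_alg G). realize G F = (\<lambda>_. 0)}"
  unfolding two_sided_ideal_def formal_alg_simps
  by (auto simp: formal_carrier_zero formal_carrier_add formal_carrier_scale formal_mult_closed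
      realize_zero realize_formal_mult convolution_zero formal_carrier_finite
      realize_add realize_scale)

text \<open>The two terms can differ only at arrows of \<open>A - B\<close>. Since the range map is
  injective on \<open>A\<close>, such arrows have ranges outside the range of \<open>B\<close>,
  where \<open>f\<close> vanishes.\<close>

lemma skew_relations_kernel:
  "skew_relations G \<subseteq> {F \<in> acarrier (formal_alg G).
    realize G F = (\<lambda>_. 0 :: 'r::{comm_ring, comm_monoid_mult})}"
proof
  fix F :: "'a set \<Rightarrow> 'a \<Rightarrow> 'r" assume "F \<in> skew_relations G"
  then obtain A B f where F: "F = (\<lambda>C x. single B f C x - single A f C x)"
    and AB: "A \<in> compact_bisections G" "B \<in> compact_bisections G" "B \<subseteq> A" "f \<in> action_dom G B"
    unfolding skew_relations_def by blast
  have F': "F = (\<lambda>C x. single B f C x + (- 1) * single A f C x)"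
    by (simp add: F)
  have "f \<in> action_dom G A"
    using AB(3,4) unfolding action_dom_def by blast
  then have "single A f \<in> acarrier (formal_alg G)" "single B f \<in> acarrier (formal_alg G)"
    using AB by (auto intro: formal_carrier_single)
  note car = this formal_carrier_scale[OF this(1), of "- 1"]
  have "realize G F b = bis_fun G B f b - bis_fun G A f b" for b
  proof -
    have "realize G F b = realize G (single B f) b + realize G (\<lambda>C x. (- 1) * single A f C x) b"
      unfolding F' by (simp only: realize_add[OF formal_carrier_finite formal_carrier_finite, OF car(2,3)])
    also have "\<dots> = bis_fun G B f b + (- 1) * bis_fun G A f b"
      by (simp only: realize_single realize_scale[OF formal_carrier_finite[OF car(1)]])
    finally show ?thesis by simp
  qed
  moreover have "bis_fun G B f b = bis_fun G A f b" for b
  proof (cases "b \<in> A - B")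
    case True
    then have "rng G b \<notin> rng G ` B"
      using AB(3) compact_bisectionsD(3)[OF AB(1)] by (auto simp: inj_on_def)
    moreover have "rng G b \<in> units G"
      using True compact_bisectionsD(5)[OF AB(1)] by (auto simp: rng_in_units)
    ultimately have "f (rng G b) = 0"
      using AB(4) by (simp add: action_dom_def)
    then show ?thesis by (simp add: bis_fun_def)
  qed (use AB(3) in \<open>auto simp: bis_fun_def\<close>)
  ultimately have "realize G F = (\<lambda>_. 0)" by auto
  moreover have "F \<in> acarrier (formal_alg G)"
    unfolding F' using car by (intro formal_carrier_add)
  ultimately show "F \<in> {F \<in> acarrier (formal_alg G). realize G F = (\<lambda>_. 0)}" by simp
qed

text \<open>The kernel is an ideal containing the relations, which gives one inclusion; every other
  such ideal contains the kernel by \<open>kernel_subset_ideal\<close>.\<close>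

lemma generated_ideal_kernel:
  "generated_ideal (formal_alg G) (skew_relations G)
    = {F \<in> acarrier (formal_alg G). realize G F = (\<lambda>_. 0)}"
proof
  show "generated_ideal (formal_alg G) (skew_relations G)
      \<subseteq> {F \<in> acarrier (formal_alg G). realize G F = (\<lambda>_. 0)}"
    using kernel_ideal skew_relations_kernel unfolding generated_ideal_def by blast
qed (auto simp: generated_ideal_def fun_eq_iff intro: kernel_subset_ideal)

lemma acoset_kernel:
  fixes F :: "'a set \<Rightarrow> 'a \<Rightarrow> 'r::{comm_ring, comm_monoid_mult}"
  assumes F: "F \<in> acarrier (formal_alg G)"
  shows "acoset (formal_alg G) {F \<in> acarrier (formal_alg G). realize G F = (\<lambda>_. 0)} F
    = {H \<in> acarrier (formal_alg G). realize G H = realize G F}" (is "acoset _ ?K F = ?R")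
proof
  show "acoset (formal_alg G) ?K F \<subseteq> ?R"
    using F by (auto simp: acoset_def formal_alg_simps formal_carrier_add realize_add
        formal_carrier_finite)
  show "?R \<subseteq> acoset (formal_alg G) ?K F"
  proof
    fix H assume H: "H \<in> ?R"
    have neg: "(\<lambda>B x. (- 1) * F B x) \<in> acarrier (formal_alg G)"
      using F by (rule formal_carrier_scale)
    \<comment> \<open>The difference of two elements of one fibre lies in the kernel and translates
      \<open>F\<close> to \<open>H\<close>.\<close>
    let ?D = "\<lambda>B x. H B x + (- 1) * F B x"
    have "?D \<in> acarrier (formal_alg G)"
      using H neg by (intro formal_carrier_add) auto
    moreover have "realize G ?D b = 0" for b
    proof -
      have "realize G ?D b = realize G H b + (- 1) * realize G F b"
        using H F neg unfolding formal_carrier_iff mem_Collect_eq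
        by (subst realize_add) (simp_all only: realize_scale)
      then show ?thesis using H by simp
    qed
    moreover have "aadd (formal_alg G) F ?D = H"
      by (simp add: formal_alg_simps)
    ultimately show "H \<in> acoset (formal_alg G) ?K F"
      unfolding acoset_def by (intro image_eqI[where x = ?D]) auto
  qed
qed

text \<open>\<open>realize G\<close> is a surjective homomorphism whose fibres are the cosets of the
  generated ideal.\<close>

lemma steinberg_alg_isomorphic_skew_ring: "alg_isomorphic (steinberg_alg G) (skew_ring G)"
  unfolding skew_ring_def generated_ideal_kernel
proof (rule alg_isomorphic_quotient_alg[where \<phi> = "realize G"])
  show "realize G ` acarrier (formal_alg G) = acarrier (steinberg_alg G)"
    by (simp add: realize_image steinberg_alg_def)
qed (auto simp: acoset_kernel formal_alg_simps steinberg_alg_def formal_carrier_add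
    formal_carrier_scale formal_mult_closed realize_formal_mult
    formal_carrier_finite realize_add realize_scale)

end

theorem theorem5p2:
  fixes G :: "'g groupoid_data"
  assumes "ample_groupoid G"
    and "Hausdorff_space (gtop G)"
  shows "alg_isomorphic
    (steinberg_alg G :: ('r::{comm_ring, comm_monoid_mult}, 'g \<Rightarrow> 'r) alg_data)
    (skew_ring G :: ('r, ('g set \<Rightarrow> 'g \<Rightarrow> 'r) set) alg_data)"
proof -
  interpret ample_Hausdorff_groupoid G
    using assms by (intro ample_Hausdorff_groupoid.intro ample_Hausdorff_groupoid_axioms.intro)
  show ?thesis by (rule steinberg_alg_isomorphic_skew_ring)
qed

end
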